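(* If $n\ge 4$ is an even integer, then $\chi(Q_{n}^{[\natural n-2]})\le \chi(J(n,n/2,1))+2$.
   Context: $Q_n^{[\natural p]}$ is the graph on $\{0,1\}^n$ in which two vertices are adjacent iff they differ in exactly $p$ coordinates. For integers $i\le k\le n$, the generalized Johnson graph $J(n,k,i)$ has vertex set $\{A\subseteq\{1,\ldots,n\}: |A|=k\}$ and edge set $\{AB: |A\cap B|=i\}$. $\chi$ denotes the chromatic number. *)

theory Defs
  imports Main "HOL-Library.FuncSet"
begin

text \<open>
  A finite simple graph is a pair of a vertex set and a set of edges, each edge being an
  unordered pair (a two-element set) of vertices.
\<close>

type_synonym 'a graph = "'a set \<times> 'a set set"

abbreviation verts :: "'a graph \<Rightarrow> 'a set" where
  "verts G \<equiv> fst G"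

abbreviation edges :: "'a graph \<Rightarrow> 'a set set" where
  "edges G \<equiv> snd G"

definition simple_graph :: "'a graph \<Rightarrow> bool" where
  "simple_graph G \<longleftrightarrow> finite (verts G) \<and> (\<forall>e\<in>edges G. e \<subseteq> verts G \<and> card e = 2)"

definition proper_colouring :: "'a graph \<Rightarrow> nat \<Rightarrow> ('a \<Rightarrow> nat) \<Rightarrow> bool" where
  "proper_colouring G k c \<longleftrightarrow>
     (\<forall>v\<in>verts G. c v < k) \<and> (\<forall>u v. {u, v} \<in> edges G \<longrightarrow> c u \<noteq> c v)"

definition chromatic_number :: "'a graph \<Rightarrow> nat" ("\<chi>'(_')") where
  "\<chi>(G) = (LEAST k. \<exists>c. proper_colouring G k c)"

text \<open>The minimum is attained for every finite simple graph, so \<open>LEAST\<close> is never a junk value.\<close>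

lemma chromatic_number_attained:
  assumes "simple_graph G"
  shows "\<exists>c. proper_colouring G \<chi>(G) c"
proof -
  have fin: "finite (verts G)"
    and edge: "\<And>e. e \<in> edges G \<Longrightarrow> e \<subseteq> verts G \<and> card e = 2"
    using assms by (auto simp: simple_graph_def)
  obtain c :: "'a \<Rightarrow> nat" where c: "bij_betw c (verts G) {0..<card (verts G)}"
    using ex_bij_betw_finite_nat[OF fin] by blast
  have "c u \<noteq> c v" if "{u, v} \<in> edges G" for u v
  proof -
    have "u \<in> verts G" "v \<in> verts G" "u \<noteq> v"
      using edge[OF that] by (auto simp: card_2_iff)
    then show ?thesis
      using c by (auto simp: bij_betw_def inj_on_def)
  qed
  moreover have "\<forall>v\<in>verts G. c v < card (verts G)"
    using c by (auto simp: bij_betw_def)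
  ultimately have "\<exists>k c. proper_colouring G k c"
    unfolding proper_colouring_def by blast
  then show ?thesis
    unfolding chromatic_number_def by (rule LeastI_ex)
qed

text \<open>
  The graph $Q_n^{[\natural p]}$: points of $\{0,1\}^n$ are extensional functions on
  \<open>{1..n}\<close>; two points are joined iff their Hamming distance is exactly \<open>p\<close>.
\<close>

definition cube_exact_distance_graph :: "nat \<Rightarrow> nat \<Rightarrow> (nat \<Rightarrow> nat) graph" where
  "cube_exact_distance_graph n p =
     (let V = {1..n} \<rightarrow>\<^sub>E {0, 1}
      in (V, {{x, y} | x y. x \<in> V \<and> y \<in> V \<and> x \<noteq> y \<and> card {j \<in> {1..n}. x j \<noteq> y j} = p}))"

definition johnson_graph :: "nat \<Rightarrow> nat \<Rightarrow> nat \<Rightarrow> nat set graph" where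
  "johnson_graph n k i =
     (let V = {A. A \<subseteq> {1..n} \<and> card A = k}
      in (V, {{A, B} | A B. A \<in> V \<and> B \<in> V \<and> A \<noteq> B \<and> card (A \<inter> B) = i}))"

lemma simple_graph_pairs:
  assumes "finite V"
  shows "simple_graph (V, {{x, y} | x y. x \<in> V \<and> y \<in> V \<and> x \<noteq> y \<and> P x y})"
proof -
  have "e \<subseteq> V \<and> card e = 2" if "e \<in> {{x, y} | x y. x \<in> V \<and> y \<in> V \<and> x \<noteq> y \<and> P x y}" for e
  proof -
    obtain x y where "e = {x, y}" "x \<in> V" "y \<in> V" "x \<noteq> y"
      using \<open>e \<in> _\<close> by blast
    then show ?thesis by simp
  qed
  then show ?thesis
    unfolding simple_graph_def using assms by simp
qed

lemma simple_graph_cube_exact_distance_graph: "simple_graph (cube_exact_distance_graph n p)"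
  unfolding cube_exact_distance_graph_def Let_def
  by (rule simple_graph_pairs) (simp add: finite_PiE)

lemma simple_graph_johnson_graph: "simple_graph (johnson_graph n k i)"
  unfolding johnson_graph_def Let_def
  by (rule simple_graph_pairs) simp

end

theory Submission
  imports Defs
begin

text \<open>
  Identify points of the cube with subsets of \<open>{1..n}\<close>, where \<open>n = 2m\<close>. Adjacent sets have
  sizes of equal parity, and toggling the element 1 maps one parity class isomorphically onto
  the other, so only sets whose size has the parity of \<open>m\<close> need to be coloured. If \<open>A\<close> and
  \<open>B\<close> have symmetric difference of size \<open>2m - 2\<close>, then \<open>2m - 2 \<le> |A| + |B| \<le> 2m + 2\<close>. Two
  sets of size at most \<open>m - 2\<close>, or two of size at least \<open>m + 2\<close>, are therefore never adjacent,
  while the sets of size exactly \<open>m\<close> induce \<open>J(n, m, 1)\<close>.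
\<close>

lemma chromatic_number_le:
  assumes "proper_colouring G k c"
  shows "\<chi>(G) \<le> k"
  unfolding chromatic_number_def using assms by (auto intro: Least_le)

lemma card_sym_diff_Int:
  assumes "finite A" "finite B"
  shows "card (sym_diff A B) + 2 * card (A \<inter> B) = card A + card B"
proof -
  have "card (sym_diff A B) = card (A - B) + card (B - A)"
    using assms by (intro card_Un_disjoint) auto
  moreover have "card A = card (A - B) + card (A \<inter> B)"
    using assms by (metis card_Int_Diff add.commute)
  moreover have "card B = card (B - A) + card (A \<inter> B)"
    using assms by (metis card_Int_Diff add.commute Int_commute)
  ultimately show ?thesis by simp
qed

text \<open>The two sets are disjoint parts of the ground set. At distance \<open>n - 2\<close> this
  leaves at most two common elements, whence the upper bound on the sum of the sizes.\<close>

lemma card_sym_diff_add_Int_le: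
  assumes "A \<subseteq> {1..n}" "B \<subseteq> {1..n::nat}"
  shows "card (sym_diff A B) + card (A \<inter> B) \<le> n"
proof -
  have "finite A" "finite B" using assms finite_subset by blast+
  then have "card (sym_diff A B) + card (A \<inter> B) = card (sym_diff A B \<union> (A \<inter> B))"
    by (intro card_Un_disjoint[symmetric]) auto
  also have "\<dots> \<le> card {1..n}"
    using assms by (intro card_mono) auto
  finally show ?thesis by simp
qed

lemma even_card_sym_diff_iff:
  assumes "finite A" "finite B"
  shows "even (card (sym_diff A B)) \<longleftrightarrow> (even (card A) \<longleftrightarrow> even (card B))"
proof -
  have "even (card (sym_diff A B) + 2 * card (A \<inter> B)) \<longleftrightarrow> even (card A + card B)"
    using card_sym_diff_Int[OF assms] by simp
  then show ?thesis by simp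
qed

definition fix_parity :: "nat \<Rightarrow> nat set \<Rightarrow> nat set" where
  "fix_parity m A = (if even (card A) = even m then A else sym_diff A {1})"

lemma even_card_fix_parity:
  assumes "finite A"
  shows "even (card (fix_parity m A)) = even m"
  using even_card_sym_diff_iff[OF assms, of "{1}"] assms
    even_card_sym_diff_iff[of "sym_diff A {1}" "{1}"]
  by (auto simp: fix_parity_def)

text \<open>Equal parity means that both sets are toggled or neither is, and toggling the same
  element in both cancels.\<close>

lemma sym_diff_fix_parity:
  assumes "even (card A) = even (card B)"
  shows "sym_diff (fix_parity m A) (fix_parity m B) = sym_diff A B"
  using assms by (auto simp: fix_parity_def)

text \<open>Meant for sets whose size has the parity of \<open>m\<close>: each outer branch then
  starts two layers away from the middle.\<close>

definition layer_colour :: "nat \<Rightarrow> nat \<Rightarrow> (nat set \<Rightarrow> nat) \<Rightarrow> nat set \<Rightarrow> nat" where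
  "layer_colour m k c A = (if card A < m then k else if card A > m then k + 1 else c A)"

lemma layer_colour_neq:
  assumes c: "proper_colouring (johnson_graph (2 * m) m 1) k c"
    and m: "m \<ge> 2"
    and sub: "A \<subseteq> {1..2 * m}" "B \<subseteq> {1..2 * m}"
    and par: "even (card A) = even m" "even (card B) = even m"
    and dist: "card (sym_diff A B) = 2 * m - 2"
  shows "layer_colour m k c A \<noteq> layer_colour m k c B"
proof -
  have fin: "finite A" "finite B" using sub finite_subset by blast+
  have eq: "2 * m - 2 + 2 * card (A \<inter> B) = card A + card B"
    using card_sym_diff_Int[OF fin] dist by simp
  have le: "card (A \<inter> B) \<le> 2"
    using card_sym_diff_add_Int_le[OF sub] dist m by linarith
  have ne: "card A \<noteq> m + 1" "card B \<noteq> m + 1" "Suc (card A) \<noteq> m" "Suc (card B) \<noteq> m"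
    using par by auto
  \<comment> \<open>Colours of middle sets stay below \<open>k\<close>, so they never clash with the
    new colours \<open>k\<close> and \<open>k + 1\<close>.\<close>
  have lt: "c X < k" if "X \<subseteq> {1..2 * m}" "card X = m" for X
    using c that by (auto simp: proper_colouring_def johnson_graph_def)
  consider "card A = m" "card B = m" | "card A = m" "card B \<noteq> m" | "card A \<noteq> m" "card B = m"
    | "card A < m" "card B > m" | "card A > m" "card B < m"
    | "card A < m" "card B < m" | "card A > m" "card B > m"
    by linarith
  then show ?thesis
  proof cases
    case 1
    then have one: "card (A \<inter> B) = 1" using eq m by linarith
    \<comment> \<open>Otherwise the intersection would have \<open>m\<close> \<ge> 2
      elements.\<close>
    then have "A \<noteq> B" using 1 m by auto
    then have "{A, B} \<in> edges (johnson_graph (2 * m) m 1)"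
      using 1 sub one by (auto simp: johnson_graph_def)
    then have "c A \<noteq> c B"
      using c by (auto simp: proper_colouring_def)
    then show ?thesis using 1 by (simp add: layer_colour_def)
  next
    case 2
    then show ?thesis using lt[OF sub(1)] by (simp add: layer_colour_def)
  next
    case 3
    then show ?thesis using lt[OF sub(2)] by (auto simp: layer_colour_def)
  next
    case 6
    \<comment> \<open>Both sizes are at most \<open>m - 2\<close>, so their sum is below the
      distance \<open>2 * m - 2\<close>.\<close>
    then show ?thesis using eq ne by linarith
  next
    case 7
    \<comment> \<open>The sizes sum to at least \<open>2 * m + 4\<close>, but \<open>eq\<close> and
      \<open>le\<close> allow at most \<open>2 * m + 2\<close>.\<close>
    then show ?thesis using eq ne le m by linarith
  qed (simp_all add: layer_colour_def)
qed

theorem theorem4p15: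
  fixes n :: nat
  assumes "n \<ge> 4" and "even n"
  shows "\<chi>(cube_exact_distance_graph n (n - 2)) \<le> \<chi>(johnson_graph n (n div 2) 1) + 2"
proof -
  define m where "m = n div 2"
  define k where "k = \<chi>(johnson_graph n m 1)"
  have n: "n = 2 * m" and m: "m \<ge> 2" using assms by (auto simp: m_def)
  obtain c where c: "proper_colouring (johnson_graph n m 1) k c"
    using chromatic_number_attained[OF simple_graph_johnson_graph] k_def by blast
  define S where "S x = {j \<in> {1..n}. x j = (1::nat)}" for x
  define T where "T x = fix_parity m (S x)" for x
  define col where "col x = layer_colour m k c (T x)" for x
  have fin: "finite (S x)" for x by (simp add: S_def)
  have T_sub: "T x \<subseteq> {1..n}" for x
    using m n by (auto simp: T_def fix_parity_def S_def)
  have T_even: "even (card (T x)) = even m" for x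
    using even_card_fix_parity[OF fin] by (simp add: T_def)
  have bound: "col x < k + 2" for x
    using c T_sub[of x]
    by (auto simp: col_def layer_colour_def proper_colouring_def johnson_graph_def
        intro: less_trans[of _ k])
  have neq: "col x \<noteq> col y"
    if x: "x \<in> {1..n} \<rightarrow>\<^sub>E {0, 1}" and y: "y \<in> {1..n} \<rightarrow>\<^sub>E {0, 1}"
      and d: "card {j \<in> {1..n}. x j \<noteq> y j} = n - 2" for x y
  proof -
    have "x j = 0 \<or> x j = 1" "y j = 0 \<or> y j = 1" if "j \<in> {1..n}" for j
      using PiE_mem[OF x that] PiE_mem[OF y that] by auto
    then have "sym_diff (S x) (S y) = {j \<in> {1..n}. x j \<noteq> y j}"
      by (fastforce simp: S_def)
    then have dS: "card (sym_diff (S x) (S y)) = 2 * m - 2"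
      using d n by simp
    \<comment> \<open>The distance is even, so adjacent points lie in the same parity class.\<close>
    then have "even (card (S x)) = even (card (S y))"
      using even_card_sym_diff_iff[OF fin fin, of x y] by simp
    then have "card (sym_diff (T x) (T y)) = 2 * m - 2"
      using dS unfolding T_def by (simp only: sym_diff_fix_parity)
    then show ?thesis
      unfolding col_def
      using c m T_sub T_even n by (intro layer_colour_neq) auto
  qed
  have "proper_colouring (cube_exact_distance_graph n (n - 2)) (k + 2) col"
    unfolding proper_colouring_def
  proof (intro conjI ballI allI impI)
    fix u v
    assume "{u, v} \<in> edges (cube_exact_distance_graph n (n - 2))"
    then obtain x y where "{u, v} = {x, y}" "x \<in> {1..n} \<rightarrow>\<^sub>E {0, 1}" "y \<in> {1..n} \<rightarrow>\<^sub>E {0, 1}"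
      "card {j \<in> {1..n}. x j \<noteq> y j} = n - 2"
      unfolding cube_exact_distance_graph_def Let_def by auto
    then show "col u \<noteq> col v"
      using neq[of x y] by (auto simp: doubleton_eq_iff)
  qed (rule bound)
  then show ?thesis
    using chromatic_number_le by (simp add: k_def m_def)
qed

end
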